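(* Let $T>0$ and let $\mathsf H:[0,T]\to\mathbb C^{N\times N}$ with $\mathsf H(t)$ Hermitian for every $t$. Let $\psi:[0,T]\to\mathbb C^N$ be differentiable, let $\varphi(t)=\begin{bmatrix}\operatorname{Re}\psi(t)\\ \operatorname{Im}\psi(t)\end{bmatrix}\in\mathbb R^{2N}$, and let $$\mathcal J(t)=\begin{bmatrix}-\operatorname{Im}\mathsf H(t)&-\operatorname{Re}\mathsf H(t)\\ \operatorname{Re}\mathsf H(t)&-\operatorname{Im}\mathsf H(t)\end{bmatrix}\in\mathbb R^{2N\times 2N}.$$ Then the Schrödinger equation $\dot\psi(t)=-i\mathsf H(t)\psi(t)$ on $[0,T]$ is equivalent to the first-order real linear system $\dot\varphi(t)=-\mathcal J(t)\varphi(t)$ on $[0,T]$.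
   Context: Overdots denote derivatives with respect to $t$ (one-sided at the endpoints of $[0,T]$). $\operatorname{Re}$ and $\operatorname{Im}$ of matrices and vectors are taken entrywise. $N=2^n$ is the dimension of the state space of $n$ qubits; $\mathsf H(t)$ is a time-dependent Hamiltonian, with $\hbar=1$. *)

theory Defs
  imports "HOL-Analysis.Analysis"
begin

definition conjugate_transpose :: "complex^'n^'m \<Rightarrow> complex^'m^'n" where
  "conjugate_transpose A = (\<chi> i j. cnj (A $ j $ i))"

definition hermitian_matrix :: "complex^'n^'n \<Rightarrow> bool" where
  "hermitian_matrix A \<longleftrightarrow> conjugate_transpose A = A"

definition Re_vec :: "complex^'n \<Rightarrow> real^'n" where
  "Re_vec v = (\<chi> i. Re (v $ i))"

definition Im_vec :: "complex^'n \<Rightarrow> real^'n" where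
  "Im_vec v = (\<chi> i. Im (v $ i))"

(* Block objects are indexed by a sum type; Inl selects the first block row or column,
   Inr the second, so that CARD('n + 'n) = 2 * CARD('n). *)

definition block_vec :: "'a^'m \<Rightarrow> 'a^'n \<Rightarrow> 'a^('m + 'n)" where
  "block_vec x y = (\<chi> i. case i of Inl k \<Rightarrow> x $ k | Inr k \<Rightarrow> y $ k)"

definition block_matrix ::
  "'a^'p^'m \<Rightarrow> 'a^'q^'m \<Rightarrow> 'a^'p^'n \<Rightarrow> 'a^'q^'n \<Rightarrow> 'a^('p + 'q)^('m + 'n)" where
  "block_matrix A B C D =
     (\<chi> i. case i of Inl k \<Rightarrow> block_vec (A $ k) (B $ k) | Inr k \<Rightarrow> block_vec (C $ k) (D $ k))"

definition real_state :: "complex^'n \<Rightarrow> real^('n + 'n)" where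
  "real_state v = block_vec (Re_vec v) (Im_vec v)"

definition real_generator :: "complex^'n^'n \<Rightarrow> real^('n + 'n)^('n + 'n)" where
  "real_generator H =
     block_matrix (- map_matrix Im H) (- map_matrix Re H)
                  (map_matrix Re H) (- map_matrix Im H)"

end

theory Submission
  imports Defs
begin

text \<open>Splitting a complex vector into real and imaginary parts is a real-linear map
  \<open>real_state\<close> with left inverse \<open>complex_state\<close>. Both are bounded, the
  spaces being finite-dimensional, so derivatives pass through them in either direction
  (\<open>has_vector_derivative_real_state_iff\<close>). In these coordinates
  \<open>real_generator H\<close> is the real matrix of multiplication by \<i>H, so the two
  right-hand sides correspond as well (\<open>real_state_schroedinger\<close>). The two equations
  are thus equivalent separately at each time t.\<close>

definition complex_state :: "real^('n + 'n) \<Rightarrow> complex^'n" where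
  "complex_state w = (\<chi> i. Complex (w $ Inl i) (w $ Inr i))"

lemma block_vec_nth [simp]:
  "block_vec x y $ Inl i = x $ i" "block_vec x y $ Inr j = y $ j"
  by (simp_all add: block_vec_def)

lemma block_matrix_nth [simp]:
  "block_matrix A B C D $ Inl i = block_vec (A $ i) (B $ i)"
  "block_matrix A B C D $ Inr j = block_vec (C $ j) (D $ j)"
  by (simp_all add: block_matrix_def)

lemma real_state_nth [simp]:
  "real_state v $ Inl i = Re (v $ i)" "real_state v $ Inr i = Im (v $ i)"
  by (simp_all add: real_state_def Re_vec_def Im_vec_def)

lemma complex_state_real_state [simp]: "complex_state (real_state v) = v"
  by (simp add: complex_state_def vec_eq_iff)

lemma vec_sum_eqI:
  fixes v w :: "'a^('m::finite + 'n::finite)"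
  assumes "\<And>i. v $ Inl i = w $ Inl i" "\<And>j. v $ Inr j = w $ Inr j"
  shows "v = w"
  unfolding vec_eq_iff by (metis assms sum.exhaust)

lemma bounded_linear_real_state: "bounded_linear real_state"
  unfolding linear_conv_bounded_linear [symmetric]
  by (rule linearI) (auto intro: vec_sum_eqI)

lemma bounded_linear_complex_state: "bounded_linear complex_state"
  unfolding linear_conv_bounded_linear [symmetric]
  by (rule linearI) (simp_all add: complex_state_def vec_eq_iff complex_eq_iff)

lemma sum_UNIV_Plus:
  fixes f :: "'m::finite + 'n::finite \<Rightarrow> 'a::comm_monoid_add"
  shows "sum f UNIV = (\<Sum>i\<in>UNIV. f (Inl i)) + (\<Sum>j\<in>UNIV. f (Inr j))"
  by (simp add: UNIV_Plus_UNIV [symmetric] sum.Plus del: UNIV_Plus_UNIV)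

text \<open>Each entry of the product is a sum over the column index, a sum type;
  \<open>sum_UNIV_Plus\<close> splits it into one sum per column block.\<close>

lemma block_matrix_vector_mult:
  fixes A :: "'a::semiring_1^'p^'m"
  shows "block_matrix A B C D *v block_vec x y = block_vec (A *v x + B *v y) (C *v x + D *v y)"
  by (rule vec_sum_eqI) (simp_all add: matrix_vector_mult_def sum_UNIV_Plus)

text \<open>With H = A + \<i>B and v = x + \<i>y, one has -\<i>Hv = (Bx + Ay) + \<i>(By - Ax), and
  these two parts are the blocks of -Jv when J is \<open>real_generator H\<close> and v is read as
  the pair (x, y).\<close>

lemma real_state_schroedinger:
  fixes H :: "complex^'n^'n"
  shows "real_state ((- \<i>) *s (H *v v)) = - (real_generator H *v real_state v)"
  unfolding real_generator_def real_state_def block_matrix_vector_mult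
  by (rule vec_sum_eqI)
    (simp_all add: Re_vec_def Im_vec_def matrix_vector_mult_def map_matrix_def sum_negf
      sum_subtractf sum.distrib algebra_simps)

text \<open>Applying \<open>real_state\<close> gives one direction. For the other, apply
  \<open>complex_state\<close> and cancel it against \<open>real_state\<close> in both the function
  and the derivative.\<close>

lemma has_vector_derivative_real_state_iff:
  "((\<lambda>t. real_state (\<psi> t)) has_vector_derivative real_state d) (at t within S)
    \<longleftrightarrow> (\<psi> has_vector_derivative d) (at t within S)"
  using bounded_linear.has_vector_derivative [OF bounded_linear_real_state, of \<psi> d "at t within S"]
    bounded_linear.has_vector_derivative [OF bounded_linear_complex_state,
      of "\<lambda>t. real_state (\<psi> t)" "real_state d" "at t within S"]
  by auto

theorem mainTheorem5:
  fixes n :: nat and T :: real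
    and H :: "real \<Rightarrow> complex^'N^'N"
    and \<psi> :: "real \<Rightarrow> complex^'N"
    and \<phi> :: "real \<Rightarrow> real^('N + 'N)"
    and J :: "real \<Rightarrow> real^('N + 'N)^('N + 'N)"
  assumes "CARD('N) = 2 ^ n"
    and "T > 0"
    and "\<And>t. t \<in> {0..T} \<Longrightarrow> hermitian_matrix (H t)"
    and "\<psi> differentiable_on {0..T}"
    and "\<And>t. t \<in> {0..T} \<Longrightarrow> \<phi> t = real_state (\<psi> t)"
    and "\<And>t. t \<in> {0..T} \<Longrightarrow> J t = real_generator (H t)"
  shows "(\<forall>t\<in>{0..T}. (\<psi> has_vector_derivative (- \<i>) *s (H t *v \<psi> t)) (at t within {0..T}))
     \<longleftrightarrow> (\<forall>t\<in>{0..T}. (\<phi> has_vector_derivative - (J t *v \<phi> t)) (at t within {0..T}))"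
\<comment> \<open>No integration or solution theory enters: the equivalence is proved at a fixed
  t.\<close>
proof (rule ball_cong [OF refl])
  fix t assume t: "t \<in> {0..T}"
  have "(\<phi> has_vector_derivative - (J t *v \<phi> t)) (at t within {0..T})
    \<longleftrightarrow> (\<phi> has_vector_derivative real_state ((- \<i>) *s (H t *v \<psi> t))) (at t within {0..T})"
    by (simp only: assms(5,6) [OF t] real_state_schroedinger)
  \<comment> \<open>\<phi> is known to equal the split of \<psi> only on [0,T]. This suffices
    because a derivative within [0,T] at a point of [0,T] depends only on values there.\<close>
  also have "\<dots> \<longleftrightarrow> ((\<lambda>t. real_state (\<psi> t)) has_vector_derivative
      real_state ((- \<i>) *s (H t *v \<psi> t))) (at t within {0..T})"
    using assms(5) t by (metis (no_types, lifting) has_vector_derivative_transform)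
  finally show "(\<psi> has_vector_derivative (- \<i>) *s (H t *v \<psi> t)) (at t within {0..T})
    \<longleftrightarrow> (\<phi> has_vector_derivative - (J t *v \<phi> t)) (at t within {0..T})"
    by (simp only: has_vector_derivative_real_state_iff)
qed

end
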